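(* Let $E$ be a two-dimensional real evolution algebra with $E^2\neq 0$. Then $E$ is isomorphic to one of the following two-dimensional real evolution algebras, each given by its products on a basis $e_1,e_2$ with $e_1e_2=e_2e_1=0$. (i) If $\dim E^2=1$, then $E$ is isomorphic to one of: $E_1$: $e_1e_1=e_1,\ e_2e_2=0$; $E_2$: $e_1e_1=e_1,\ e_2e_2=e_1$; $E_3$: $e_1e_1=e_1+e_2,\ e_2e_2=-e_1-e_2$; $E_4$: $e_1e_1=e_2,\ e_2e_2=0$; $E_5$: $e_1e_1=e_2,\ e_2e_2=-e_2$. (ii) If $\dim E^2=2$, then $E$ is isomorphic to one of: $E_6(a_2;a_3)$: $e_1e_1=e_1+a_2e_2,\ e_2e_2=a_3e_1+e_2$, where $a_2,a_3\in\mathbb{R}$ and $1-a_2a_3\neq 0$; $E_7(a_4)$: $e_1e_1=e_2,\ e_2e_2=e_1+a_4e_2$, where $a_4\in\mathbb{R}$. Moreover, $E_6(a_2;a_3)$ is isomorphic to $E_6(a_3;a_2)$, and apart from these isomorphisms the listed algebras (over all admissible parameter values) are pairwise non-isomorphic.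
   Context: A (finite-dimensional) real evolution algebra is an algebra $E$ over $\mathbb{R}$ (a real vector space with a bilinear product, not assumed associative) that admits a basis $e_1,\dots,e_n$, called a natural basis, such that $e_i e_j=0$ for $i\neq j$ and $e_ie_i=\sum_k a_{ik}e_k$ for some $a_{ik}\in\mathbb{R}$. $E^2$ denotes the linear span of all products $xy$ with $x,y\in E$. Isomorphism means isomorphism of $\mathbb{R}$-algebras (not required to preserve a chosen basis). *)

theory Defs
  imports "HOL-Analysis.Analysis"
begin

text \<open>An algebra over the reals is a real vector space (a type of class
  \<^class>\<open>real_vector\<close>) together with a bilinear product on it, not assumed associative.\<close>

definition natural_basis :: "('a::real_vector \<Rightarrow> 'a \<Rightarrow> 'a) \<Rightarrow> 'a set \<Rightarrow> bool" where
  "natural_basis mul B \<longleftrightarrow>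
     finite B \<and> independent B \<and> span B = UNIV \<and>
     (\<forall>x\<in>B. \<forall>y\<in>B. x \<noteq> y \<longrightarrow> mul x y = 0)"

definition evolution_algebra :: "('a::real_vector \<Rightarrow> 'a \<Rightarrow> 'a) \<Rightarrow> bool" where
  "evolution_algebra mul \<longleftrightarrow> bilinear mul \<and> (\<exists>B. natural_basis mul B)"

definition alg_square :: "('a::real_vector \<Rightarrow> 'a \<Rightarrow> 'a) \<Rightarrow> 'a set" where
  "alg_square mul = span {mul x y | x y. True}"

definition alg_isomorphic ::
  "('a::real_vector \<Rightarrow> 'a \<Rightarrow> 'a) \<Rightarrow> ('b::real_vector \<Rightarrow> 'b \<Rightarrow> 'b) \<Rightarrow> bool" where
  "alg_isomorphic mulA mulB \<longleftrightarrow>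
     (\<exists>f. linear f \<and> bij f \<and> (\<forall>x y. f (mulA x y) = mulB (f x) (f y)))"

text \<open>Row \<open>i\<close> of the structure matrix \<open>A\<close> is the square of the \<open>i\<close>-th standard basis vector;
  products of distinct standard basis vectors vanish.\<close>

definition evol_mul :: "real^'n^'n \<Rightarrow> real^'n \<Rightarrow> real^'n \<Rightarrow> real^'n" where
  "evol_mul A x y = (\<Sum>i\<in>UNIV. (x $ i * y $ i) *\<^sub>R A $ i)"

datatype evo2 = E1 | E2 | E3 | E4 | E5 | E6 real real | E7 real

primrec structure_matrix :: "evo2 \<Rightarrow> real^2^2" where
  "structure_matrix E1 = vector [vector [1, 0], vector [0, 0]]"
| "structure_matrix E2 = vector [vector [1, 0], vector [1, 0]]"
| "structure_matrix E3 = vector [vector [1, 1], vector [-1, -1]]"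
| "structure_matrix E4 = vector [vector [0, 1], vector [0, 0]]"
| "structure_matrix E5 = vector [vector [0, 1], vector [0, -1]]"
| "structure_matrix (E6 a2 a3) = vector [vector [1, a2], vector [a3, 1]]"
| "structure_matrix (E7 a4) = vector [vector [0, 1], vector [1, a4]]"

primrec admissible :: "evo2 \<Rightarrow> bool" where
  "admissible E1 = True"
| "admissible E2 = True"
| "admissible E3 = True"
| "admissible E4 = True"
| "admissible E5 = True"
| "admissible (E6 a2 a3) = (1 - a2 * a3 \<noteq> 0)"
| "admissible (E7 a4) = True"

definition evo2_mul :: "evo2 \<Rightarrow> real^2 \<Rightarrow> real^2 \<Rightarrow> real^2" where
  "evo2_mul p = evol_mul (structure_matrix p)"

lemma evol_mul_axis:
  "evol_mul A (axis i 1) (axis j 1) = (if i = j then A $ i else 0)"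
proof -
  have "evol_mul A (axis i 1) (axis j 1)
      = (\<Sum>k\<in>UNIV. if k = i then (if i = j then A $ i else 0) else 0)"
    unfolding evol_mul_def by (rule sum.cong) (auto simp: axis_def)
  then show ?thesis by simp
qed

lemma evolution_algebra_evol_mul: "evolution_algebra (evol_mul A)"
proof -
  have "bilinear (evol_mul A)"
    unfolding bilinear_def evol_mul_def
    by (auto intro!: linearI simp: algebra_simps sum.distrib scaleR_sum_right)
  moreover have "evol_mul A x y = 0"
    if xy: "x \<in> Basis" "y \<in> Basis" "x \<noteq> y" for x y
  proof -
    obtain i j where "x = axis i 1" "y = axis j 1"
      using xy by (auto simp: Basis_vec_def)
    with xy show ?thesis by (auto simp: evol_mul_axis)
  qed
  then have "natural_basis (evol_mul A) Basis"
    by (auto simp: natural_basis_def independent_Basis)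
  ultimately show ?thesis unfolding evolution_algebra_def by blast
qed

end

theory Submission imports Defs begin

text \<open>Expanding in a natural basis identifies the algebra with \<^term>\<open>evol_mul A\<close> for a
  \<open>2\<times>2\<close> matrix \<open>A\<close> (\<open>evolution_algebra_structure_matrix\<close>), and \<open>E\<^sup>2\<close> is then the row
  space of \<open>A\<close>. So \<open>dim E\<^sup>2\<close> is the rank of \<open>A\<close>, and the two parts of the classification are
  the singular and the invertible structure matrices. An isomorphism between two such algebras is a
  second basis of the target, orthogonal for the product, whose squares have the prescribed
  coordinates (\<open>evol_mul_2_isomorphic_iff\<close>); every existence and non-existence claim becomes a
  question about two vectors \<open>u\<close> and \<open>v\<close>.

  If \<open>A\<close> has rank one, its rows are \<open>a w\<close> and \<open>b w\<close>, and the product is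
  \<open>x y = D(x, y) w\<close> for the symmetric bilinear form \<open>D\<close> with matrix \<open>diag(a, b)\<close>. The pair
  \<open>(D, w)\<close> is determined by the algebra up to replacing it by \<open>(D / k, k w)\<close> with \<open>k \<noteq> 0\<close>. Hence
  two things survive an isomorphism: whether \<open>D\<close> is definite, indefinite or degenerate, which is
  the sign of \<open>a b\<close>, and whether \<open>D(w, w) = 0\<close>
  (\<open>proportional_rows_isomorphic_invariants\<close>). A definite form has no non-zero null vector, so five
  combinations remain, and they are the five algebras of the list:
  degenerate with \<open>D(w, w) \<noteq> 0\<close> (\<open>E1\<close>) or \<open>D(w, w) = 0\<close> (\<open>E4\<close>), definite (\<open>E2\<close>),
  indefinite with \<open>D(w, w) \<noteq> 0\<close> (\<open>E5\<close>) or \<open>D(w, w) = 0\<close> (\<open>E3\<close>). Conversely the invariants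
  suffice: when \<open>D(w, w) \<noteq> 0\<close> one builds the new basis from \<open>w\<close> and a vector orthogonal to it.

  If \<open>A\<close> is invertible, the two squares \<open>e\<^sub>1 e\<^sub>1\<close> and \<open>e\<^sub>2 e\<^sub>2\<close> are linearly independent. Then
  \<open>u v = u\<^sub>1 v\<^sub>1 e\<^sub>1 e\<^sub>1 + u\<^sub>2 v\<^sub>2 e\<^sub>2 e\<^sub>2\<close> vanishes only if both coefficients do, so the natural
  basis is unique up to order and scaling (\<open>det_nonzero_isomorphism_monomial\<close>). Rescaling turns both
  diagonal entries into \<open>1\<close> when they are non-zero, which gives \<open>E6\<close>; when one of them vanishes,
  a cube root normalises both off-diagonal entries to \<open>1\<close>, which gives \<open>E7\<close>. The only
  freedom left is the order of the basis, which is the exchange of the parameters of \<open>E6\<close>. For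
  \<open>E7\<close> rigidity rests on \<open>1\<close> being the only real cube root of \<open>1\<close>.\<close>

section \<open>Isomorphisms of algebras\<close>

lemma alg_isomorphic_sym:
  assumes "alg_isomorphic mulA mulB"
  shows "alg_isomorphic mulB mulA"
proof -
  obtain f where f: "linear f" "bij f" "\<And>x y. f (mulA x y) = mulB (f x) (f y)"
    using assms unfolding alg_isomorphic_def by blast
  have inv: "inv f y = x \<longleftrightarrow> y = f x" for x y
    using bij_inv_eq_iff[OF f(2)] by metis
  have f_inv: "f (inv f y) = y" for y
    by (meson bij_is_surj f(2) surj_f_inv_f)
  have "linear (inv f)"
    by (rule linearI) (simp_all add: inv linear_add[OF f(1)] linear_scale[OF f(1)] f_inv)
  moreover have "inv f (mulB x y) = mulA (inv f x) (inv f y)" for x y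
    by (simp add: inv f(3) f_inv)
  ultimately show ?thesis
    unfolding alg_isomorphic_def using bij_imp_bij_inv[OF f(2)] by blast
qed

lemma alg_isomorphic_trans:
  assumes "alg_isomorphic mulA mulB" and "alg_isomorphic mulB mulC"
  shows "alg_isomorphic mulA mulC"
proof -
  obtain f g where "linear f" "bij f" "\<And>x y. f (mulA x y) = mulB (f x) (f y)"
    and "linear g" "bij g" "\<And>x y. g (mulB x y) = mulC (g x) (g y)"
    using assms unfolding alg_isomorphic_def by blast
  then show ?thesis
    unfolding alg_isomorphic_def
    by (intro exI[of _ "g \<circ> f"]) (auto simp: linear_compose bij_comp)
qed

text \<open>The abstract algebra lives on a bare real vector space, so dimensions are compared through
  bases instead of through a type of fixed finite dimension.\<close>

lemma dim_linear_inj_image: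
  assumes "linear f" and "inj f"
  shows "dim (f ` S) = dim S"
proof -
  obtain B where B: "B \<subseteq> S" "independent B" "S \<subseteq> span B" "card B = dim S"
    by (rule basis_exists)
  have "span B = span S"
    using B by (metis span_mono span_span subset_antisym)
  then have "span (f ` B) = span (f ` S)"
    by (simp add: linear_span_image[OF assms(1)])
  moreover have "independent (f ` B)"
    using assms B(2) by (intro linear_independent_injective_image) (auto simp: inj_on_def)
  ultimately have "dim (f ` S) = card (f ` B)"
    by (rule dim_eq_card)
  also have "\<dots> = card B"
    using assms(2) by (intro card_image) (auto simp: inj_on_def)
  finally show ?thesis
    using B(4) by simp
qed

lemma alg_isomorphic_dim_square:
  assumes "alg_isomorphic mulA mulB"
  shows "dim (alg_square mulA) = dim (alg_square mulB)"
proof -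
  obtain f where f: "linear f" "bij f" "\<And>x y. f (mulA x y) = mulB (f x) (f y)"
    using assms unfolding alg_isomorphic_def by blast
  have "{mulB x y | x y. True} = f ` {mulA x y | x y. True}" (is "?L = f ` ?R")
  proof (intro equalityI subsetI)
    fix z assume "z \<in> ?L"
    then obtain x y where "z = mulB x y" by blast
    then have "z = f (mulA (inv f x) (inv f y))"
      using f by (simp add: bij_is_surj surj_f_inv_f)
    then show "z \<in> f ` ?R" by blast
  qed (use f(3) in auto)
  then have "alg_square mulB = f ` alg_square mulA"
    by (simp add: alg_square_def linear_span_image[OF f(1)])
  then show ?thesis
    using f by (simp add: dim_linear_inj_image bij_is_inj)
qed

section \<open>Structure matrices\<close>

lemma bilinear_evol_mul: "bilinear (evol_mul A)"
  using evolution_algebra_evol_mul[of A] unfolding evolution_algebra_def by blast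

text \<open>The coordinate map of a family \<open>b\<close> sends standard basis vectors to the \<open>b i\<close>, and by
  bilinearity it is enough to compare products there.\<close>

lemma evol_mul_isomorphicI:
  fixes A :: "real^'n^'n" and b :: "'n \<Rightarrow> 'a::real_vector"
  assumes mul: "bilinear mul"
    and bij: "bij (\<lambda>x. \<Sum>i\<in>UNIV. (x $ i) *\<^sub>R b i)"
    and orth: "\<And>i j. i \<noteq> j \<Longrightarrow> mul (b i) (b j) = 0"
    and sq: "\<And>i. mul (b i) (b i) = (\<Sum>k\<in>UNIV. (A $ i $ k) *\<^sub>R b k)"
  shows "alg_isomorphic (evol_mul A) mul"
proof -
  define f where "f x = (\<Sum>i\<in>UNIV. (x $ i) *\<^sub>R b i)" for x :: "real^'n"
  have lin: "linear f"
    by (rule linearI)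
      (simp_all add: f_def scaleR_add_left sum.distrib scaleR_sum_right)
  have "f (evol_mul A x y) = mul (f x) (f y)" for x y
  proof -
    have "mul (f x) (f y)
        = (\<Sum>i\<in>UNIV. \<Sum>j\<in>UNIV. (x $ i * y $ j) *\<^sub>R mul (b i) (b j))"
      unfolding f_def bilinear_sum[OF mul] sum.cartesian_product[symmetric]
      by (simp add: bilinear_lmul[OF mul] bilinear_rmul[OF mul] mult.commute)
    also have "\<dots> = (\<Sum>i\<in>UNIV. \<Sum>j\<in>UNIV.
        if j = i then (x $ i * y $ i) *\<^sub>R mul (b i) (b i) else 0)"
      by (intro sum.cong refl) (auto simp: orth)
    also have "\<dots> = (\<Sum>i\<in>UNIV. (x $ i * y $ i) *\<^sub>R f (A $ i))"
      by (simp add: sq f_def)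
    also have "\<dots> = f (evol_mul A x y)"
      by (simp add: evol_mul_def linear_sum[OF lin] linear_scale[OF lin])
    finally show ?thesis by simp
  qed
  moreover have "bij f"
    using bij unfolding f_def .
  ultimately show ?thesis
    unfolding alg_isomorphic_def using lin by blast
qed

lemma bij_basis_combination:
  fixes b :: "'n::finite \<Rightarrow> 'a::real_vector"
  assumes inj: "inj b" and ind: "independent (range b)" and span: "span (range b) = UNIV"
  shows "bij (\<lambda>x::real^'n. \<Sum>i\<in>UNIV. (x $ i) *\<^sub>R b i)"
proof -
  define f where "f x = (\<Sum>i\<in>UNIV. (x $ i) *\<^sub>R b i)" for x :: "real^'n"
  have lin: "linear f"
    by (rule linearI)
      (simp_all add: f_def scaleR_add_left sum.distrib scaleR_sum_right)
  have reindex: "(\<Sum>w\<in>range b. c w *\<^sub>R w) = (\<Sum>i\<in>UNIV. c (b i) *\<^sub>R b i)" for c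
    by (simp add: sum.reindex[OF inj])
  have "x = 0" if "f x = 0" for x
  proof -
    have "(\<Sum>w\<in>range b. (x $ inv b w) *\<^sub>R w) = 0"
      using that by (simp add: reindex f_def inv_f_f[OF inj])
    then have "\<forall>w\<in>range b. x $ inv b w = 0"
      using independentD[OF ind, of "range b" "\<lambda>w. x $ inv b w"] by auto
    then show ?thesis
      by (simp add: vec_eq_iff inv_f_f[OF inj])
  qed
  then have "inj f"
    using linear_injective_0[OF lin] by blast
  moreover have "y \<in> range f" for y
  proof -
    have "y \<in> span (range b)"
      using span by simp
    then obtain c where "y = (\<Sum>w\<in>range b. c w *\<^sub>R w)"
      by (auto simp: span_finite)
    then have "y = f (\<chi> i. c (b i))"
      by (simp add: reindex f_def)
    then show ?thesis by blast
  qed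
  ultimately show ?thesis
    unfolding f_def bij_def by blast
qed

lemma evolution_algebra_structure_matrix:
  fixes mul :: "'a::real_vector \<Rightarrow> 'a \<Rightarrow> 'a"
  assumes "evolution_algebra mul" and dim: "dim (UNIV :: 'a set) = CARD('n::finite)"
  obtains A :: "real^'n^'n" where "alg_isomorphic mul (evol_mul A)"
proof -
  obtain B where mul: "bilinear mul" and B: "finite B" "independent B" "span B = UNIV"
    and orth: "\<And>x y. x \<in> B \<Longrightarrow> y \<in> B \<Longrightarrow> x \<noteq> y \<Longrightarrow> mul x y = 0"
    using assms(1) unfolding evolution_algebra_def natural_basis_def by metis
  have "card B = CARD('n)"
    using dim_eq_card[of B UNIV] B dim by simp
  then obtain b :: "'n \<Rightarrow> 'a" where b: "bij_betw b UNIV B"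
    using finite_same_card_bij[of "UNIV :: 'n set" B] B(1) by auto
  then have inj: "inj b" and range: "range b = B"
    by (auto simp: bij_betw_def)
  have bij: "bij (\<lambda>x::real^'n. \<Sum>i\<in>UNIV. (x $ i) *\<^sub>R b i)"
    by (rule bij_basis_combination) (use inj range B in auto)
  have "\<exists>a::real^'n. mul (b i) (b i) = (\<Sum>k\<in>UNIV. (a $ k) *\<^sub>R b k)" for i
    using bij_is_surj[OF bij] unfolding surj_def by blast
  then obtain a :: "'n \<Rightarrow> real^'n"
    where "\<And>i. mul (b i) (b i) = (\<Sum>k\<in>UNIV. (a i $ k) *\<^sub>R b k)"
    by metis
  then have "alg_isomorphic (evol_mul (\<chi> i. a i)) mul"
    using mul bij inj range orth
    by (intro evol_mul_isomorphicI[where b = b]) (auto simp: inj_eq)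
  then show ?thesis
    using that alg_isomorphic_sym by blast
qed

text \<open>The rows of \<open>A\<close> are the squares of the standard basis vectors, and every product is a
  combination of them.\<close>

lemma dim_alg_square_evol_mul:
  "dim (alg_square (evol_mul A)) = rank A"
proof -
  have "span {evol_mul A x y | x y. True} = span (rows A)"
  proof (rule span_eq[THEN iffD2], intro conjI subsetI)
    fix z assume "z \<in> {evol_mul A x y | x y. True}"
    then show "z \<in> span (rows A)"
      unfolding evol_mul_def rows_def row_def
      by (auto intro!: span_sum span_scale intro: span_base)
  next
    fix z assume "z \<in> rows A"
    then obtain i where "z = evol_mul A (axis i 1) (axis i 1)"
      by (auto simp: rows_def row_def evol_mul_axis)
    then show "z \<in> span {evol_mul A x y | x y. True}"
      by (blast intro: span_base)
  qed
  then show ?thesis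
    by (simp add: alg_square_def row_rank_def dim_span)
qed

lemma alg_isomorphic_det_eq_0_iff:
  fixes A B :: "real^'n^'n"
  assumes "alg_isomorphic (evol_mul A) (evol_mul B)"
  shows "det A = 0 \<longleftrightarrow> det B = 0"
  using alg_isomorphic_dim_square[OF assms]
  by (simp add: det_eq_0_rank dim_alg_square_evol_mul)

section \<open>Two-dimensional evolution algebras\<close>

lemma evol_mul_2:
  fixes A :: "real^2^2"
  shows "evol_mul A x y = (x $ 1 * y $ 1) *\<^sub>R A $ 1 + (x $ 2 * y $ 2) *\<^sub>R A $ 2"
  by (simp add: evol_mul_def sum_2)

text \<open>The vectors \<open>u\<close> and \<open>v\<close> are the images of the two standard basis vectors: the determinant
  condition says that they form a basis, and the equations say that the product table of this basis
  is \<open>A\<close>.\<close>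

lemma evol_mul_2_isomorphic_iff:
  fixes A B :: "real^2^2"
  shows "alg_isomorphic (evol_mul A) (evol_mul B) \<longleftrightarrow>
    (\<exists>u v. u $ 1 * v $ 2 - u $ 2 * v $ 1 \<noteq> 0 \<and> evol_mul B u v = 0 \<and>
       evol_mul B u u = (A $ 1 $ 1) *\<^sub>R u + (A $ 1 $ 2) *\<^sub>R v \<and>
       evol_mul B v v = (A $ 2 $ 1) *\<^sub>R u + (A $ 2 $ 2) *\<^sub>R v)"
    (is "?L \<longleftrightarrow> (\<exists>u v. ?R u v)")
proof
  assume ?L
  then obtain f where f: "linear f" "bij f"
    "\<And>x y. f (evol_mul A x y) = evol_mul B (f x) (f y)"
    unfolding alg_isomorphic_def by blast
  have mat: "(*v) (matrix f) = f"
    using matrix_works[of f] f(1) by (auto simp: linear_def scalar_mult_eq_scaleR fun_eq_iff)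
  have "invertible (matrix f)"
    using f(2) by (simp add: invertible_eq_bij mat)
  then have "det (matrix f) \<noteq> 0"
    by (simp add: invertible_det_nz)
  then have det: "f (axis 1 1) $ 1 * f (axis 2 1) $ 2 - f (axis 1 1) $ 2 * f (axis 2 1) $ 1 \<noteq> 0"
    by (simp add: det_2 matrix_def mult.commute)
  have row: "f (A $ i) = (A $ i $ 1) *\<^sub>R f (axis 1 1) + (A $ i $ 2) *\<^sub>R f (axis 2 1)" for i
  proof -
    have "A $ i = (A $ i $ 1) *\<^sub>R axis 1 1 + (A $ i $ 2) *\<^sub>R axis 2 1"
      by (simp add: vec_eq_iff forall_2 axis_def)
    then have "f (A $ i) = f ((A $ i $ 1) *\<^sub>R axis 1 1 + (A $ i $ 2) *\<^sub>R axis 2 1)"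
      by (rule arg_cong)
    then show ?thesis
      by (simp only: linear_add[OF f(1)] linear_scale[OF f(1)])
  qed
  have "evol_mul B (f (axis i 1)) (f (axis j 1)) = (if i = j then f (A $ i) else 0)" for i j
    using linear_0[OF f(1)] by (simp add: f(3)[symmetric] evol_mul_axis)
  then have "?R (f (axis 1 1)) (f (axis 2 1))"
    using det row by simp
  then show "\<exists>u v. ?R u v" by blast
next
  assume "\<exists>u v. ?R u v"
  then obtain u v where uv: "?R u v" by blast
  define b :: "2 \<Rightarrow> real^2" where "b i = (if i = 1 then u else v)" for i
  define P :: "real^2^2" where "P = vector [vector [u $ 1, v $ 1], vector [u $ 2, v $ 2]]"
  have "det P \<noteq> 0"
    using uv by (simp add: P_def det_2 mult.commute)
  then have "bij ((*v) P)"
    by (simp add: invertible_eq_bij[symmetric] invertible_det_nz)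
  moreover have "(*v) P = (\<lambda>x. \<Sum>i\<in>UNIV. (x $ i) *\<^sub>R b i)"
    by (simp add: fun_eq_iff vec_eq_iff forall_2 sum_2 matrix_vector_mult_def P_def b_def
        mult.commute)
  ultimately have bij: "bij (\<lambda>x. \<Sum>i\<in>UNIV. (x $ i) *\<^sub>R b i)"
    by simp
  have comm: "evol_mul B v u = evol_mul B u v"
    by (simp add: evol_mul_def mult.commute)
  have "evol_mul B (b i) (b j) = 0" if "i \<noteq> j" for i j
    using that uv comm exhaust_2[of i] exhaust_2[of j] by (auto simp: b_def)
  moreover have "evol_mul B (b i) (b i) = (\<Sum>k\<in>UNIV. (A $ i $ k) *\<^sub>R b k)" for i
    using uv exhaust_2[of i] by (auto simp: b_def sum_2)
  ultimately show ?L
    using bilinear_evol_mul bij by (intro evol_mul_isomorphicI[where b = b])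
qed

text \<open>Exchanging the two basis vectors reverses both the rows and the columns of the structure
  matrix.\<close>

lemma evol_mul_swap_isomorphic:
  "alg_isomorphic (evol_mul (vector [vector [d, c], vector [b, a]] :: real^2^2))
     (evol_mul (vector [vector [a, b], vector [c, d]] :: real^2^2))"
  unfolding evol_mul_2_isomorphic_iff
  by (rule exI[of _ "vector [0, 1]"], rule exI[of _ "vector [1, 0]"])
    (simp add: evol_mul_2 vec_eq_iff forall_2)

section \<open>One-dimensional square\<close>

definition proportional_rows :: "real \<Rightarrow> real \<Rightarrow> real^2 \<Rightarrow> real^2^2" where
  "proportional_rows a b w = vector [a *\<^sub>R w, b *\<^sub>R w]"

definition weighted_inner :: "real \<Rightarrow> real \<Rightarrow> real^2 \<Rightarrow> real^2 \<Rightarrow> real" where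
  "weighted_inner a b x y = a * x $ 1 * y $ 1 + b * x $ 2 * y $ 2"

lemma evol_mul_proportional_rows:
  "evol_mul (proportional_rows a b w) x y = weighted_inner a b x y *\<^sub>R w"
  by (simp add: evol_mul_2 proportional_rows_def weighted_inner_def algebra_simps)

lemma evo2_mul_proportional_rows:
  "evo2_mul E1 = evol_mul (proportional_rows 1 0 (vector [1, 0]))"
  "evo2_mul E2 = evol_mul (proportional_rows 1 1 (vector [1, 0]))"
  "evo2_mul E3 = evol_mul (proportional_rows 1 (-1) (vector [1, 1]))"
  "evo2_mul E4 = evol_mul (proportional_rows 1 0 (vector [0, 1]))"
  "evo2_mul E5 = evol_mul (proportional_rows 1 (-1) (vector [0, 1]))"
  by (auto simp: evo2_mul_def proportional_rows_def vec_eq_iff forall_2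
      intro!: arg_cong[of _ _ evol_mul])

lemma det_eq_0_proportional_rows:
  fixes A :: "real^2^2"
  assumes "det A = 0" and "A \<noteq> 0"
  obtains a b w where "A = proportional_rows a b w" "a \<noteq> 0 \<or> b \<noteq> 0" "w \<noteq> 0"
proof (cases "A $ 1 = 0")
  case True
  then have "A = proportional_rows 0 1 (A $ 2)" "A $ 2 \<noteq> 0"
    using assms(2) by (auto simp: proportional_rows_def vec_eq_iff forall_2)
  then show ?thesis using that by force
next
  case False
  define b where "b = (if A $ 1 $ 1 = 0 then A $ 2 $ 2 / A $ 1 $ 2 else A $ 2 $ 1 / A $ 1 $ 1)"
  have "A = proportional_rows 1 b (A $ 1)"
    using assms(1) False
    by (auto simp: proportional_rows_def b_def vec_eq_iff forall_2 det_2 field_simps)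
  then show ?thesis using that False by force
qed

text \<open>The common factor \<open>w\<close> of all products spans \<open>E\<^sup>2\<close>, so an isomorphism \<open>f\<close> maps it to
  \<open>k w'\<close> for some \<open>k \<noteq> 0\<close>, and then \<open>D'(f x, f y) = k D(x, y)\<close>. Taking Gram determinants
  changes \<open>a b\<close> by the positive factor \<open>k\<^sup>2\<close> over a square, and evaluating at \<open>w\<close> gives
  \<open>D(w, w) = k D'(w', w')\<close>.\<close>

lemma proportional_rows_isomorphic_invariants:
  assumes iso: "alg_isomorphic (evol_mul (proportional_rows a b w))
      (evol_mul (proportional_rows a' b' w'))"
    and ab: "a \<noteq> 0 \<or> b \<noteq> 0" and w: "w \<noteq> 0"
  shows "sgn (a * b) = sgn (a' * b') \<and>
    (weighted_inner a b w w = 0 \<longleftrightarrow> weighted_inner a' b' w' w' = 0)"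
proof
  obtain u v where indep: "u $ 1 * v $ 2 - u $ 2 * v $ 1 \<noteq> 0"
    and uv: "weighted_inner a' b' u v *\<^sub>R w' = 0"
    and uu: "weighted_inner a' b' u u *\<^sub>R w' = a *\<^sub>R ((w $ 1) *\<^sub>R u + (w $ 2) *\<^sub>R v)"
    and vv: "weighted_inner a' b' v v *\<^sub>R w' = b *\<^sub>R ((w $ 1) *\<^sub>R u + (w $ 2) *\<^sub>R v)"
    using iso unfolding evol_mul_2_isomorphic_iff evol_mul_proportional_rows
    by (auto simp: proportional_rows_def scaleR_add_right)
  \<comment> \<open>the image of \<open>w\<close> under the isomorphism\<close>
  define fw where "fw = (w $ 1) *\<^sub>R u + (w $ 2) *\<^sub>R v"
  have fw0: "fw \<noteq> 0"
  proof
    assume "fw = 0"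
    then have 1: "w $ 1 * u $ 1 + w $ 2 * v $ 1 = 0" and 2: "w $ 1 * u $ 2 + w $ 2 * v $ 2 = 0"
      by (simp_all add: fw_def vec_eq_iff forall_2)
    have "w $ 1 * (u $ 1 * v $ 2 - u $ 2 * v $ 1) = 0"
      using 1 2 by algebra
    moreover have "w $ 2 * (u $ 1 * v $ 2 - u $ 2 * v $ 1) = 0"
      using 1 2 by algebra
    ultimately show False
      using indep w by (simp add: vec_eq_iff forall_2)
  qed
  have "\<exists>k. fw = k *\<^sub>R w'"
  proof (cases "a = 0")
    case True
    then show ?thesis using vv ab unfolding fw_def[symmetric]
      by (metis scaleR_scaleR scaleR_one left_inverse)
  next
    case False
    then show ?thesis using uu unfolding fw_def[symmetric]
      by (metis scaleR_scaleR scaleR_one left_inverse)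
  qed
  then obtain k where k: "fw = k *\<^sub>R w'" by blast
  have k0: "k \<noteq> 0" and w'0: "w' \<noteq> 0"
    using fw0 k by auto
  have uv': "weighted_inner a' b' u v = 0"
    using uv w'0 by simp
  have "weighted_inner a' b' u u *\<^sub>R w' = (a * k) *\<^sub>R w'"
    using uu k by (simp add: fw_def)
  then have uu': "weighted_inner a' b' u u = a * k"
    using w'0 by simp
  have "weighted_inner a' b' v v *\<^sub>R w' = (b * k) *\<^sub>R w'"
    using vv k by (simp add: fw_def)
  then have vv': "weighted_inner a' b' v v = b * k"
    using w'0 by simp
  \<comment> \<open>Gram determinant of \<open>u\<close>, \<open>v\<close> for the target form\<close>
  have "(a' * b') * (u $ 1 * v $ 2 - u $ 2 * v $ 1)\<^sup>2
      = weighted_inner a' b' u u * weighted_inner a' b' v v - (weighted_inner a' b' u v)\<^sup>2"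
    unfolding weighted_inner_def by algebra
  also have "\<dots> = (a * b) * k\<^sup>2"
    using uu' vv' uv' by (simp add: power2_eq_square)
  finally have "sgn ((a' * b') * (u $ 1 * v $ 2 - u $ 2 * v $ 1)\<^sup>2) = sgn ((a * b) * k\<^sup>2)"
    by simp
  moreover have "sgn (x\<^sup>2) = 1" if "x \<noteq> 0" for x :: real
    using that by (simp add: sgn_if)
  ultimately show "sgn (a * b) = sgn (a' * b')"
    using indep k0 by (simp add: sgn_mult)
  have "weighted_inner a' b' fw fw = (w $ 1)\<^sup>2 * weighted_inner a' b' u u
      + 2 * (w $ 1 * w $ 2) * weighted_inner a' b' u v + (w $ 2)\<^sup>2 * weighted_inner a' b' v v"
    by (simp add: weighted_inner_def fw_def power2_eq_square algebra_simps)
  also have "\<dots> = k * weighted_inner a b w w"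
    unfolding uu' vv' uv' by (simp add: weighted_inner_def power2_eq_square algebra_simps)
  finally have "k * weighted_inner a b w w = k\<^sup>2 * weighted_inner a' b' w' w'"
    by (simp add: k weighted_inner_def power2_eq_square algebra_simps)
  then show "weighted_inner a b w w = 0 \<longleftrightarrow> weighted_inner a' b' w' w' = 0"
    using k0 by auto
qed

lemma proportional_rows_swap_isomorphic:
  "alg_isomorphic (evol_mul (proportional_rows a b w))
     (evol_mul (proportional_rows b a (vector [w $ 2, w $ 1])))"
proof -
  have "proportional_rows a b w
      = vector [vector [a * w $ 1, a * w $ 2], vector [b * w $ 1, b * w $ 2]]"
    "proportional_rows b a (vector [w $ 2, w $ 1])
      = vector [vector [b * w $ 2, b * w $ 1], vector [a * w $ 2, a * w $ 1]]"
    by (simp_all add: proportional_rows_def vec_eq_iff forall_2)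
  then show ?thesis
    using evol_mul_swap_isomorphic by simp
qed

text \<open>Here \<open>u\<close> and \<open>v\<close> lie in the source algebra: the point of this form is to look for a
  normalised basis inside the given algebra \<open>(a, b, w)\<close>.\<close>

lemma isomorphic_proportional_rowsI:
  assumes "u $ 1 * v $ 2 - u $ 2 * v $ 1 \<noteq> 0" and "weighted_inner a b u v = 0"
    and "weighted_inner a b u u *\<^sub>R w = a' *\<^sub>R ((w' $ 1) *\<^sub>R u + (w' $ 2) *\<^sub>R v)"
    and "weighted_inner a b v v *\<^sub>R w = b' *\<^sub>R ((w' $ 1) *\<^sub>R u + (w' $ 2) *\<^sub>R v)"
  shows "alg_isomorphic (evol_mul (proportional_rows a b w))
    (evol_mul (proportional_rows a' b' w'))"
proof (rule alg_isomorphic_sym)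
  show "alg_isomorphic (evol_mul (proportional_rows a' b' w'))
      (evol_mul (proportional_rows a b w))"
    unfolding evol_mul_2_isomorphic_iff evol_mul_proportional_rows
    by (rule exI[of _ u], rule exI[of _ v])
      (use assms in \<open>simp add: proportional_rows_def scaleR_add_right\<close>)
qed

text \<open>The radical of the form is spanned by the second basis vector. If \<open>w\<close> is not in it, a multiple of
  \<open>w\<close> is idempotent and, with the radical, gives \<open>E1\<close>; if \<open>w\<close> is in it, all products of three
  factors vanish and the algebra is \<open>E4\<close>.\<close>

lemma proportional_rows_isomorphic_E1_E4:
  assumes a: "a \<noteq> 0" and w: "w \<noteq> 0"
  shows "\<exists>p\<in>{E1, E4}. alg_isomorphic (evol_mul (proportional_rows a 0 w)) (evo2_mul p)"
proof (cases "w $ 1 = 0")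
  case True
  then have w2: "w $ 2 \<noteq> 0"
    using w by (simp add: vec_eq_iff forall_2)
  have "alg_isomorphic (evol_mul (proportional_rows a 0 w)) (evo2_mul E4)"
    unfolding evo2_mul_proportional_rows
    by (rule isomorphic_proportional_rowsI[where u = "vector [1, 0]" and v = "a *\<^sub>R w"])
      (use a w2 True in \<open>simp_all add: weighted_inner_def\<close>)
  then show ?thesis by simp
next
  case False
  define N where "N = weighted_inner a 0 w w"
  have N: "N \<noteq> 0"
    using a False by (simp add: N_def weighted_inner_def)
  have "alg_isomorphic (evol_mul (proportional_rows a 0 w)) (evo2_mul E1)"
    unfolding evo2_mul_proportional_rows
  proof (rule isomorphic_proportional_rowsI[where u = "(1 / N) *\<^sub>R w" and v = "vector [0, 1]"])
    have "weighted_inner a 0 ((1 / N) *\<^sub>R w) ((1 / N) *\<^sub>R w) = N / N\<^sup>2"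
      by (simp add: N_def weighted_inner_def power2_eq_square)
    then show "weighted_inner a 0 ((1 / N) *\<^sub>R w) ((1 / N) *\<^sub>R w) *\<^sub>R w
      = 1 *\<^sub>R ((vector [1, 0] :: real^2) $ 1 *\<^sub>R (1 / N) *\<^sub>R w
          + (vector [1, 0] :: real^2) $ 2 *\<^sub>R vector [0, 1])"
      using N by (simp add: power2_eq_square)
  qed (use N False in \<open>simp_all add: weighted_inner_def\<close>)
  then show ?thesis by simp
qed

text \<open>When \<open>w\<close> is not null, the idempotent \<open>e = w / D(w, w)\<close> is completed by an orthogonal vector
  \<open>n\<close>, scaled so that \<open>n n\<close> is \<open>e\<close> or \<open>- e\<close>; the sign is that of \<open>D(e, e) D(n, n)\<close>, which
  is the sign of \<open>a b\<close>. In the negative case the pair \<open>n\<close>, \<open>- e\<close> has the product table of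
  \<open>E5\<close>. When \<open>w\<close> is null, rescaling the given basis alone reaches \<open>E3\<close>.\<close>

lemma proportional_rows_isomorphic_E2_E3_E5:
  assumes ab: "a * b \<noteq> 0" and w: "w \<noteq> 0"
  shows "\<exists>p\<in>{E2, E3, E5}. alg_isomorphic (evol_mul (proportional_rows a b w)) (evo2_mul p)"
proof (cases "weighted_inner a b w w = 0")
  case True
  then have null: "a * (w $ 1)\<^sup>2 + b * (w $ 2)\<^sup>2 = 0"
    by (simp add: weighted_inner_def power2_eq_square)
  have a0: "a \<noteq> 0" and w1: "w $ 1 \<noteq> 0" and w2: "w $ 2 \<noteq> 0"
    using null ab w by (auto simp: vec_eq_iff forall_2)
  have b: "b = - a * (w $ 1)\<^sup>2 / (w $ 2)\<^sup>2"
    using null w2 by (simp add: field_simps)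
  \<comment> \<open>the coordinates of \<open>u\<close> and \<open>v\<close> are forced by \<open>u u = u + v\<close>; nullity of \<open>w\<close> gives \<open>v v = - (u + v)\<close>\<close>
  have "alg_isomorphic (evol_mul (proportional_rows a b w)) (evo2_mul E3)"
    unfolding evo2_mul_proportional_rows
    by (rule isomorphic_proportional_rowsI[where
          u = "vector [1 / (a * w $ 1), 0]" and v = "vector [0, w $ 2 / (a * (w $ 1)\<^sup>2)]"])
      (use a0 w1 w2 in \<open>simp_all add: weighted_inner_def b vec_eq_iff forall_2
         field_simps power2_eq_square\<close>)
  then show ?thesis by simp
next
  case False
  define N where "N = weighted_inner a b w w"
  \<comment> \<open>makes \<open>D(n, n) = \<plusminus> D(e, e)\<close>, since the unscaled vector has \<open>D\<close>-square \<open>a b N\<close>\<close>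
  define c where "c = 1 / (N * sqrt \<bar>a * b\<bar>)"
  define e where "e = (1 / N) *\<^sub>R w"
  define n where "n = c *\<^sub>R (vector [- b * w $ 2, a * w $ 1] :: real^2)"
  have N: "N \<noteq> 0" and c0: "c \<noteq> 0"
    using False ab by (auto simp: N_def c_def)
  have c2: "c\<^sup>2 * \<bar>a * b\<bar> = 1 / N\<^sup>2"
    using N ab by (simp add: c_def power_mult_distrib power_divide)
  have ee: "weighted_inner a b e e = 1 / N"
  proof -
    have "weighted_inner a b e e = N / N\<^sup>2"
      by (simp add: e_def N_def weighted_inner_def power2_eq_square add_divide_distrib)
    then show ?thesis using N by (simp add: power2_eq_square)
  qed
  have en: "weighted_inner a b e n = 0" "weighted_inner a b n e = 0"
    by (simp_all add: e_def n_def weighted_inner_def)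
  have nn: "weighted_inner a b n n = sgn (a * b) / N"
  proof -
    have "weighted_inner a b n n = c\<^sup>2 * (a * b) * N"
      by (simp add: n_def N_def weighted_inner_def power2_eq_square algebra_simps)
    also have "\<dots> = sgn (a * b) * (c\<^sup>2 * \<bar>a * b\<bar>) * N"
      using sgn_mult_abs[of "a * b"] by algebra
    finally show ?thesis
      using N unfolding c2 by (simp add: power2_eq_square)
  qed
  have det: "e $ 1 * n $ 2 - e $ 2 * n $ 1 = c"
  proof -
    have "e $ 1 * n $ 2 - e $ 2 * n $ 1 = c * N / N"
      by (simp add: e_def n_def N_def weighted_inner_def diff_divide_distrib[symmetric]
          add_divide_distrib[symmetric] algebra_simps)
    then show ?thesis using N by simp
  qed
  show ?thesis
  proof (cases "a * b > 0")
    case True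
    have "alg_isomorphic (evol_mul (proportional_rows a b w)) (evo2_mul E2)"
      unfolding evo2_mul_proportional_rows
      by (rule isomorphic_proportional_rowsI[where u = e and v = n])
        (use det c0 in \<open>simp_all add: ee en nn True\<close>, simp_all add: e_def)
    then show ?thesis by simp
  next
    case False
    then have "sgn (a * b) = - 1"
      using ab by (simp add: sgn_if)
    have "alg_isomorphic (evol_mul (proportional_rows a b w)) (evo2_mul E5)"
      unfolding evo2_mul_proportional_rows
    proof (rule isomorphic_proportional_rowsI[where u = n and v = "- e"])
      show "n $ 1 * (- e) $ 2 - n $ 2 * (- e) $ 1 \<noteq> 0"
        using det c0 by (simp add: mult.commute)
    qed (use ee en nn \<open>sgn (a * b) = - 1\<close> in \<open>simp_all add: weighted_inner_def e_def\<close>)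
    then show ?thesis by simp
  qed
qed

lemma det_eq_0_classification:
  fixes A :: "real^2^2"
  assumes "det A = 0" and "A \<noteq> 0"
  shows "\<exists>p\<in>{E1, E2, E3, E4, E5}. alg_isomorphic (evol_mul A) (evo2_mul p)"
proof -
  obtain a b w where A: "A = proportional_rows a b w" and ab: "a \<noteq> 0 \<or> b \<noteq> 0" and w: "w \<noteq> 0"
    using det_eq_0_proportional_rows assms by blast
  consider "a * b \<noteq> 0" | "a \<noteq> 0" "b = 0" | "a = 0" "b \<noteq> 0"
    using ab by auto
  then show ?thesis
  proof cases
    case 1
    then show ?thesis
      using proportional_rows_isomorphic_E2_E3_E5[OF _ w] A by blast
  next
    case 2
    then show ?thesis
      using proportional_rows_isomorphic_E1_E4[OF _ w] A by blast
  next
    case 3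
    have "(vector [w $ 2, w $ 1] :: real^2) \<noteq> 0"
      using w by (auto simp: vec_eq_iff forall_2)
    from proportional_rows_isomorphic_E1_E4[OF 3(2) this] show ?thesis
      using proportional_rows_swap_isomorphic[of a b w] alg_isomorphic_trans A 3(1) by blast
  qed
qed

section \<open>Two-dimensional square\<close>

text \<open>Orthogonality of \<open>u\<close> and \<open>v\<close> is a linear relation between the rows of the invertible matrix
  \<open>B\<close>, so \<open>u\<^sub>1 v\<^sub>1 = u\<^sub>2 v\<^sub>2 = 0\<close>; as \<open>u\<close> and \<open>v\<close> are independent, each is a multiple
  of a standard basis vector.\<close>

lemma det_nonzero_isomorphism_monomial:
  fixes A B :: "real^2^2"
  assumes iso: "alg_isomorphic (evol_mul A) (evol_mul B)" and det: "det B \<noteq> 0"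
  obtains
    (diagonal) p s where "p \<noteq> 0" "s \<noteq> 0"
      "A $ 1 $ 1 = p * B $ 1 $ 1" "A $ 1 $ 2 * s = p\<^sup>2 * B $ 1 $ 2"
      "A $ 2 $ 1 * p = s\<^sup>2 * B $ 2 $ 1" "A $ 2 $ 2 = s * B $ 2 $ 2"
  | (antidiagonal) q r where "q \<noteq> 0" "r \<noteq> 0"
      "A $ 1 $ 1 = q * B $ 2 $ 2" "A $ 1 $ 2 * r = q\<^sup>2 * B $ 2 $ 1"
      "A $ 2 $ 1 * q = r\<^sup>2 * B $ 1 $ 2" "A $ 2 $ 2 = r * B $ 1 $ 1"
proof -
  obtain u v where indep: "u $ 1 * v $ 2 - u $ 2 * v $ 1 \<noteq> 0" and uv: "evol_mul B u v = 0"
    and uu: "evol_mul B u u = (A $ 1 $ 1) *\<^sub>R u + (A $ 1 $ 2) *\<^sub>R v"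
    and vv: "evol_mul B v v = (A $ 2 $ 1) *\<^sub>R u + (A $ 2 $ 2) *\<^sub>R v"
    using iso unfolding evol_mul_2_isomorphic_iff by blast
  note scalars = evol_mul_2 vec_eq_iff forall_2 power2_eq_square
  have 1: "u $ 1 * v $ 1 * B $ 1 $ 1 + u $ 2 * v $ 2 * B $ 2 $ 1 = 0"
    and 2: "u $ 1 * v $ 1 * B $ 1 $ 2 + u $ 2 * v $ 2 * B $ 2 $ 2 = 0"
    using uv by (simp_all add: scalars)
  have "(u $ 1 * v $ 1) * det B = 0" "(u $ 2 * v $ 2) * det B = 0"
    using 1 2 unfolding det_2 by algebra+
  then have "u $ 1 * v $ 1 = 0" "u $ 2 * v $ 2 = 0"
    using det by auto
  then consider "u $ 2 = 0" "v $ 1 = 0" "u $ 1 \<noteq> 0" "v $ 2 \<noteq> 0"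
    | "u $ 1 = 0" "v $ 2 = 0" "u $ 2 \<noteq> 0" "v $ 1 \<noteq> 0"
    using indep by auto
  then show ?thesis
  proof cases
    case 1
    then show ?thesis
      using uu vv by (intro diagonal[of "u $ 1" "v $ 2"]) (auto simp: scalars)
  next
    case 2
    then show ?thesis
      using uu vv by (intro antidiagonal[of "u $ 2" "v $ 1"]) (auto simp: scalars)
  qed
qed

text \<open>Scaling the basis by \<open>s\<close> and \<open>t\<close> must give \<open>s\<^sup>2 b = t\<close> and \<open>t\<^sup>2 c = s\<close>; eliminating
  \<open>t\<close> leaves \<open>s\<^sup>3 = 1 / (b\<^sup>2 c)\<close>, which has a real solution for either sign of \<open>c\<close>.\<close>

lemma det_nonzero_isomorphic_E7:
  fixes a b c d :: real
  assumes "b \<noteq> 0" "c \<noteq> 0"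
  shows "\<exists>a4. alg_isomorphic (evol_mul (vector [vector [0, b], vector [c, d]] :: real^2^2))
    (evo2_mul (E7 a4))"
proof -
  define s where "s = root 3 (1 / (b\<^sup>2 * c))"
  define t where "t = s\<^sup>2 * b"
  have s3: "s ^ 3 = 1 / (b\<^sup>2 * c)"
    unfolding s_def by (rule odd_real_root_pow) simp
  then have s0: "s \<noteq> 0" using assms by auto
  have "t\<^sup>2 * c = s * (s ^ 3 * (b\<^sup>2 * c))"
    by (simp add: t_def power2_eq_square power3_eq_cube algebra_simps)
  then have t2: "t\<^sup>2 * c = s"
    using s3 assms by (simp add: power2_eq_square)
  have t0: "t \<noteq> 0" using s0 assms by (simp add: t_def)
  have "alg_isomorphic (evo2_mul (E7 (t * d))) (evol_mul (vector [vector [0, b], vector [c, d]] :: real^2^2))"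
    unfolding evo2_mul_def evol_mul_2_isomorphic_iff
    by (rule exI[of _ "vector [s, 0]"], rule exI[of _ "vector [0, t]"])
      (use s0 t0 t2 in \<open>simp add: evol_mul_2 vec_eq_iff forall_2 t_def[symmetric]
         power2_eq_square[symmetric] mult.assoc\<close>)
  then show ?thesis using alg_isomorphic_sym by blast
qed

lemma det_nonzero_classification:
  fixes A :: "real^2^2"
  assumes det: "det A \<noteq> 0"
  shows "(\<exists>a2 a3. 1 - a2 * a3 \<noteq> 0 \<and> alg_isomorphic (evol_mul A) (evo2_mul (E6 a2 a3))) \<or>
    (\<exists>a4. alg_isomorphic (evol_mul A) (evo2_mul (E7 a4)))"
proof -
  define a b c d where "a = A $ 1 $ 1" "b = A $ 1 $ 2" "c = A $ 2 $ 1" "d = A $ 2 $ 2"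
  then have A: "A = vector [vector [a, b], vector [c, d]]"
    by (simp add: vec_eq_iff forall_2)
  have det': "a * d - b * c \<noteq> 0"
    using det by (simp add: A det_2)
  consider "a \<noteq> 0" "d \<noteq> 0" | "a = 0" | "d = 0" by blast
  then show ?thesis
  proof cases
    case 1
    \<comment> \<open>scaling by \<open>1 / a\<close> and \<open>1 / d\<close> normalises the diagonal\<close>
    have "alg_isomorphic (evo2_mul (E6 (b * d / a\<^sup>2) (c * a / d\<^sup>2))) (evol_mul A)"
      unfolding evo2_mul_def evol_mul_2_isomorphic_iff A
      by (rule exI[of _ "vector [1 / a, 0]"], rule exI[of _ "vector [0, 1 / d]"])
        (use 1 in \<open>simp add: evol_mul_2 vec_eq_iff forall_2 power2_eq_square\<close>)
    moreover have "1 - (b * d / a\<^sup>2) * (c * a / d\<^sup>2) \<noteq> 0"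
      using 1 det' by (simp add: field_simps power2_eq_square)
    ultimately show ?thesis using alg_isomorphic_sym by blast
  next
    case 2
    then show ?thesis
      using det_nonzero_isomorphic_E7[of b c d] det' A by auto
  next
    case 3
    then obtain a4 where
      "alg_isomorphic (evol_mul (vector [vector [0, c], vector [b, a]] :: real^2^2))
        (evo2_mul (E7 a4))"
      using det_nonzero_isomorphic_E7[of c b a] det' by auto
    moreover have "alg_isomorphic (evol_mul A)
        (evol_mul (vector [vector [0, c], vector [b, a]] :: real^2^2))"
      using evol_mul_swap_isomorphic[of a b c d] 3 A by simp
    ultimately show ?thesis using alg_isomorphic_trans by blast
  qed
qed

section \<open>The classification\<close>

lemma evo2_isomorphic_one_dimensional_square_eq:
  assumes p: "p \<in> {E1, E2, E3, E4, E5}" and q: "q \<in> {E1, E2, E3, E4, E5}"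
    and iso: "alg_isomorphic (evo2_mul p) (evo2_mul q)"
  shows "p = q"
proof -
  have w: "(vector [1, 0] :: real^2) \<noteq> 0" "(vector [0, 1] :: real^2) \<noteq> 0"
    "(vector [1, 1] :: real^2) \<noteq> 0"
    by (simp_all add: vec_eq_iff forall_2)
  show ?thesis
    using p q iso
    by (auto simp: evo2_mul_proportional_rows weighted_inner_def w
        dest!: proportional_rows_isomorphic_invariants)
qed

lemma evo2_isomorphic_two_dimensional_square:
  assumes det: "det (structure_matrix p) \<noteq> 0" "det (structure_matrix q) \<noteq> 0"
    and iso: "alg_isomorphic (evo2_mul p) (evo2_mul q)"
  shows "p = q \<or> (\<exists>a2 a3. p = E6 a2 a3 \<and> q = E6 a3 a2)"
proof -
  have kinds: "(\<exists>x y. r = E6 x y) \<or> (\<exists>x. r = E7 x)" if "det (structure_matrix r) \<noteq> 0" for r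
    using that by (cases r) (auto simp: det_2)
  \<comment> \<open>a diagonal isomorphism between algebras \<open>E7\<close> scales by \<open>z\<close> and \<open>t = z\<^sup>2\<close> with \<open>t\<^sup>2 = z\<close>\<close>
  have fixed_cube: "z = 1" if "z * z = t" "t * t = z" "z \<noteq> 0" for z t :: real
  proof -
    have "(z * z) * (z * z) = z" using that by simp
    then have "z * (z ^ 3 - 1) = 0" by (simp add: power3_eq_cube algebra_simps)
    then have "z ^ 3 = 1" using that by simp
    then show ?thesis using odd_real_root_power_cancel[of 3 z] by simp
  qed
  from iso[unfolded evo2_mul_def] det(2) show ?thesis
  proof (cases rule: det_nonzero_isomorphism_monomial)
    case (diagonal x y)
    then show ?thesis
      using kinds[OF det(1)] kinds[OF det(2)] fixed_cube[of x y] by (auto simp: power2_eq_square)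
  next
    case (antidiagonal x y)
    then show ?thesis
      using kinds[OF det(1)] kinds[OF det(2)] by (auto simp: power2_eq_square)
  qed
qed

lemma evo2_isomorphic_cases:
  assumes adm: "admissible p" "admissible q"
    and iso: "alg_isomorphic (evo2_mul p) (evo2_mul q)"
  shows "p = q \<or> (\<exists>a2 a3. p = E6 a2 a3 \<and> q = E6 a3 a2)"
proof (cases "det (structure_matrix p) = 0")
  case True
  have degenerate: "r \<in> {E1, E2, E3, E4, E5}" if "det (structure_matrix r) = 0" "admissible r" for r
    using that by (cases r) (auto simp: det_2)
  have "det (structure_matrix q) = 0"
    using alg_isomorphic_det_eq_0_iff[OF iso[unfolded evo2_mul_def]] True by simp
  then have "p = q"
    by (intro evo2_isomorphic_one_dimensional_square_eq degenerate True adm iso)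
  then show ?thesis ..
next
  case False
  then show ?thesis
    using evo2_isomorphic_two_dimensional_square[OF _ _ iso]
      alg_isomorphic_det_eq_0_iff[OF iso[unfolded evo2_mul_def]] by simp
qed

lemma E6_swap_isomorphic:
  "alg_isomorphic (evo2_mul (E6 a2 a3)) (evo2_mul (E6 a3 a2))"
  using evol_mul_swap_isomorphic[of 1 a2 a3 1] by (simp add: evo2_mul_def)

lemma two_dimensional_classification:
  fixes mul :: "'a::real_vector \<Rightarrow> 'a \<Rightarrow> 'a"
  assumes ev: "evolution_algebra mul" and dim: "dim (UNIV :: 'a set) = 2"
    and nonzero: "alg_square mul \<noteq> {0}"
  shows "(dim (alg_square mul) = 1 \<and>
      (\<exists>p\<in>{E1, E2, E3, E4, E5}. alg_isomorphic mul (evo2_mul p))) \<or>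
    (dim (alg_square mul) = 2 \<and>
      ((\<exists>a2 a3. 1 - a2 * a3 \<noteq> 0 \<and> alg_isomorphic mul (evo2_mul (E6 a2 a3))) \<or>
       (\<exists>a4. alg_isomorphic mul (evo2_mul (E7 a4)))))"
proof -
  obtain A :: "real^2^2" where A: "alg_isomorphic mul (evol_mul A)"
    by (rule evolution_algebra_structure_matrix[where 'n = 2, OF ev]) (use dim in simp)
  have rank: "dim (alg_square mul) = rank A"
    using alg_isomorphic_dim_square[OF A] by (simp add: dim_alg_square_evol_mul)
  have "A \<noteq> 0"
  proof
    assume "A = 0"
    obtain f where f: "linear f" "bij f" "\<And>x y. f (mul x y) = evol_mul A (f x) (f y)"
      using A unfolding alg_isomorphic_def by blast
    have "mul x y = 0" for x y
    proof (rule injD[OF bij_is_inj[OF f(2)]])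
      show "f (mul x y) = f 0"
        by (simp add: f(3) \<open>A = 0\<close> evol_mul_def linear_0[OF f(1)])
    qed
    then show False
      using nonzero by (simp add: alg_square_def)
  qed
  then have "rank A \<noteq> 0"
    by (simp add: rank_eq_0)
  moreover have "rank A \<le> 2"
    using rank_bound[of A] by simp
  ultimately consider "rank A = 1" | "rank A = 2" by linarith
  then show ?thesis
  proof cases
    case 1
    then have "det A = 0" by (simp add: det_eq_0_rank)
    then obtain p where "p \<in> {E1, E2, E3, E4, E5}" "alg_isomorphic (evol_mul A) (evo2_mul p)"
      using det_eq_0_classification \<open>A \<noteq> 0\<close> by blast
    then show ?thesis
      using alg_isomorphic_trans[OF A] 1 rank by metis
  next
    case 2
    then have "det A \<noteq> 0" by (simp add: det_eq_0_rank)
    from det_nonzero_classification[OF this] show ?thesis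
      using alg_isomorphic_trans[OF A] 2 rank by metis
  qed
qed

theorem theorem1:
  "(\<forall>mul :: 'a::real_vector \<Rightarrow> 'a \<Rightarrow> 'a.
      evolution_algebra mul \<and> dim (UNIV :: 'a set) = 2 \<and> alg_square mul \<noteq> {0} \<longrightarrow>
        (\<exists>p. admissible p \<and> alg_isomorphic mul (evo2_mul p)) \<and>
        (dim (alg_square mul) = 1 \<longrightarrow>
           (\<exists>p\<in>{E1, E2, E3, E4, E5}. alg_isomorphic mul (evo2_mul p))) \<and>
        (dim (alg_square mul) = 2 \<longrightarrow>
           (\<exists>a2 a3. 1 - a2 * a3 \<noteq> 0 \<and> alg_isomorphic mul (evo2_mul (E6 a2 a3))) \<or>
           (\<exists>a4. alg_isomorphic mul (evo2_mul (E7 a4))))) \<and>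
   (\<forall>a2 a3. 1 - a2 * a3 \<noteq> 0 \<longrightarrow>
      alg_isomorphic (evo2_mul (E6 a2 a3)) (evo2_mul (E6 a3 a2))) \<and>
   (\<forall>p q. admissible p \<and> admissible q \<and> alg_isomorphic (evo2_mul p) (evo2_mul q) \<longrightarrow>
      p = q \<or> (\<exists>a2 a3. p = E6 a2 a3 \<and> q = E6 a3 a2))"
proof (intro conjI allI impI; (elim conjE)?)
  fix mul :: "'a \<Rightarrow> 'a \<Rightarrow> 'a"
  assume "evolution_algebra mul" "dim (UNIV :: 'a set) = 2" "alg_square mul \<noteq> {0}"
  note cl = two_dimensional_classification[OF this]
  have adm: "admissible r" if "r \<in> {E1, E2, E3, E4, E5}" for r
    using that by auto
  show "\<exists>p. admissible p \<and> alg_isomorphic mul (evo2_mul p)"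
    using cl adm admissible.simps(6,7) by metis
  show "\<exists>p\<in>{E1, E2, E3, E4, E5}. alg_isomorphic mul (evo2_mul p)"
    if "dim (alg_square mul) = 1"
    using cl that by auto
  show "(\<exists>a2 a3. 1 - a2 * a3 \<noteq> 0 \<and> alg_isomorphic mul (evo2_mul (E6 a2 a3))) \<or>
      (\<exists>a4. alg_isomorphic mul (evo2_mul (E7 a4)))"
    if "dim (alg_square mul) = 2"
    using cl that by auto
next
  show "alg_isomorphic (evo2_mul (E6 a2 a3)) (evo2_mul (E6 a3 a2))" for a2 a3
    by (rule E6_swap_isomorphic)
next
  show "p = q \<or> (\<exists>a2 a3. p = E6 a2 a3 \<and> q = E6 a3 a2)"
    if "admissible p" "admissible q" "alg_isomorphic (evo2_mul p) (evo2_mul q)" for p q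
    using that by (rule evo2_isomorphic_cases)
qed

end
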